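(* Let $p$ be a prime. The independence polynomial $I(\varGamma(\mathbb{Z}_{p^3}), x)$ of the zero divisor graph $\varGamma(\mathbb{Z}_{p^3})$ is log-concave and unimodal.
   Context: For a positive integer $n$, the zero divisor graph $\varGamma(\mathbb{Z}_n)$ is the simple undirected graph whose vertices are the non-zero zero divisors of the ring $\mathbb{Z}_n$ of integers modulo $n$ (non-zero $a$ such that $ab=0$ for some non-zero $b$), two distinct vertices $a,b$ being adjacent if and only if $ab=0$ in $\mathbb{Z}_n$. An independent set of a finite graph $G$ is a set of vertices no two of which are adjacent (the empty set included); $\alpha(G)$ is the maximum size of an independent set, and $s_k(G)$ is the number of independent sets of size $k$. The independence polynomial of $G$ is $I(G,x)=\sum_{k=0}^{\alpha(G)} s_k(G)x^k$. A polynomial $\sum_{i=0}^{n}\ell_i x^i$ (of degree $n$) is log-concave if $\ell_j^2\ge \ell_{j-1}\ell_{j+1}$ for all $1\le j\le n-1$; it is unimodal if there is an index $m$, $0\le m\le n$, with $\ell_0\le \ell_1\le\dots\le \ell_m\ge \ell_{m+1}\ge\dots\ge \ell_n$. *)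

theory Defs
  imports
    "HOL-Number_Theory.Residues"
    "HOL-Computational_Algebra.Polynomial"
    "Graph_Theory.Pair_Digraph"
begin

text \<open>
  A simple undirected graph is represented as a symmetric loop-free pair digraph
  (\<open>pair_graph\<close>): an edge is a pair of opposite arcs.
\<close>

definition nonzero_zero_divisors :: "('a, 'm) ring_scheme \<Rightarrow> 'a set" where
  "nonzero_zero_divisors R =
    {a \<in> carrier R. a \<noteq> \<zero>\<^bsub>R\<^esub> \<and>
      (\<exists>b \<in> carrier R. b \<noteq> \<zero>\<^bsub>R\<^esub> \<and> a \<otimes>\<^bsub>R\<^esub> b = \<zero>\<^bsub>R\<^esub>)}"

definition zero_divisor_graph :: "('a, 'm) ring_scheme \<Rightarrow> 'a pair_pre_digraph" where
  "zero_divisor_graph R =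
    \<lparr> pverts = nonzero_zero_divisors R,
      parcs = {(a, b). a \<in> nonzero_zero_divisors R \<and> b \<in> nonzero_zero_divisors R \<and>
                 a \<noteq> b \<and> a \<otimes>\<^bsub>R\<^esub> b = \<zero>\<^bsub>R\<^esub>} \<rparr>"

lemma pair_graph_zero_divisor_graph:
  assumes "cring R" and "finite (carrier R)"
  shows "pair_graph (zero_divisor_graph R)"
proof -
  interpret cring R by fact
  have fin: "finite (nonzero_zero_divisors R)"
    using assms(2) by (simp add: nonzero_zero_divisors_def)
  have sub: "nonzero_zero_divisors R \<subseteq> carrier R"
    by (auto simp: nonzero_zero_divisors_def)
  have "finite (parcs (zero_divisor_graph R))"
    by (rule finite_subset[OF _ finite_cartesian_product[OF fin fin]])
      (auto simp: zero_divisor_graph_def)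
  moreover have "sym (parcs (zero_divisor_graph R))"
    using sub by (auto simp: sym_def zero_divisor_graph_def m_comm subset_iff)
  ultimately show ?thesis
    using fin by unfold_locales (auto simp: zero_divisor_graph_def symmetric_def)
qed

definition indep_set :: "'a pair_pre_digraph \<Rightarrow> 'a set \<Rightarrow> bool" where
  "indep_set G S \<longleftrightarrow> S \<subseteq> pverts G \<and> (\<forall>u \<in> S. \<forall>v \<in> S. (u, v) \<notin> parcs G)"

text \<open>The next three definitions are meant for graphs with finitely many vertices.\<close>

definition independence_number :: "'a pair_pre_digraph \<Rightarrow> nat" where
  "independence_number G = Max {card S | S. indep_set G S}"

definition num_indep_sets :: "'a pair_pre_digraph \<Rightarrow> nat \<Rightarrow> nat" where
  "num_indep_sets G k = card {S. indep_set G S \<and> card S = k}"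

definition independence_poly :: "'a pair_pre_digraph \<Rightarrow> int poly" where
  "independence_poly G =
    (\<Sum>k = 0..independence_number G. monom (int (num_indep_sets G k)) k)"

definition log_concave_poly :: "'a::linordered_idom poly \<Rightarrow> bool" where
  "log_concave_poly f \<longleftrightarrow>
    (\<forall>j. 1 \<le> j \<and> j + 1 \<le> degree f \<longrightarrow>
      coeff f (j - 1) * coeff f (j + 1) \<le> (coeff f j)\<^sup>2)"

definition unimodal_poly :: "'a::linordered_idom poly \<Rightarrow> bool" where
  "unimodal_poly f \<longleftrightarrow>
    (\<exists>m \<le> degree f.
      (\<forall>i. i < m \<longrightarrow> coeff f i \<le> coeff f (i + 1)) \<and>
      (\<forall>i. m \<le> i \<and> i < degree f \<longrightarrow> coeff f (i + 1) \<le> coeff f i))"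

end

theory Submission
  imports Defs
begin

text \<open>
  The vertices of the graph are the nonzero multiples of \<open>p\<close> modulo \<open>p\<^sup>3\<close>. Those divisible by
  \<open>p\<^sup>2\<close> are adjacent to every other vertex, and the remaining \<open>N = p\<^sup>2 - p\<close> are pairwise
  non-adjacent. Hence the independence polynomial is \<open>(1 + x)\<^sup>N + (p - 1) x\<close>. Only the linear
  coefficient differs from that of \<open>(1 + x)\<^sup>N\<close>, and the slack in the log-concavity of the
  binomial coefficients absorbs the perturbation because \<open>2 (p - 1) \<le> N\<close>. Unimodality follows
  since all coefficients are positive.
\<close>

section \<open>From log-concavity to unimodality\<close>

lemma log_concave_imp_unimodal_poly:
  fixes f :: "'a::linordered_idom poly"
  assumes lc: "log_concave_poly f" and pos: "\<And>i. i \<le> degree f \<Longrightarrow> coeff f i > 0"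
  shows "unimodal_poly f"
proof -
  \<comment> \<open>The peak \<open>m\<close> is the first index at which the coefficients fail to
    rise strictly; counting \<open>degree f\<close> as such an index makes \<open>LEAST\<close> well
    defined.\<close>
  define P where "P i \<longleftrightarrow> i = degree f \<or> coeff f (i + 1) \<le> coeff f i" for i
  define m where "m = (LEAST i. P i)"
  have "P (degree f)"
    by (simp add: P_def)
  then have Pm: "P m" and m_le: "m \<le> degree f"
    unfolding m_def by (rule LeastI, rule Least_le)
  have up: "coeff f i \<le> coeff f (i + 1)" if "i < m" for i
    using not_less_Least[of i P] that by (auto simp: m_def P_def)
  have down: "coeff f (i + 1) \<le> coeff f i" if "m \<le> i" "i < degree f" for i
    using that
  proof (induction i rule: dec_induct)
    case base
    then show ?case using Pm by (auto simp: P_def)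
  next
    case (step i)
    then have le: "coeff f (i + 1) \<le> coeff f i" by simp
    have p: "coeff f i > 0" "coeff f (i + 1) > 0"
      using step.prems by (auto intro: pos)
    \<comment> \<open>Log-concavity at \<open>i + 1\<close>, divided by the positive
      \<open>coeff f i\<close>, carries a descent at \<open>i\<close> over to
      \<open>i + 1\<close>.\<close>
    have "coeff f i * coeff f (i + 2) \<le> (coeff f (i + 1))\<^sup>2"
      using lc step.prems by (auto simp: log_concave_poly_def dest: spec[of _ "i + 1"])
    also have "\<dots> \<le> coeff f i * coeff f (i + 1)"
      using le p by (simp add: power2_eq_square)
    finally show ?case using p by simp
  qed
  show ?thesis
    unfolding unimodal_poly_def using m_le up down by blast
qed

section \<open>Inequalities between binomial coefficients\<close>

lemma binomial_step: "(n choose Suc k) * Suc k = (n choose k) * (n - k)"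
  \<comment> \<open>Both sides equal \<open>n * ((n - 1) choose k)\<close>.\<close>
  using binomial_absorb_comp[of n k] binomial_absorption[of k n]
  by (simp add: mult.commute)

lemma binomial_log_concave:
  "(n choose k) * (n choose Suc (Suc k)) \<le> (n choose Suc k)\<^sup>2"
proof (cases "Suc k < n")
  case True
  define a b c where "a = n choose k" and "b = n choose Suc k" and "c = n choose Suc (Suc k)"
  \<comment> \<open>Multiplying by \<open>w\<close> lets \<open>binomial_step\<close> turn both
    \<open>a\<close> and \<open>c\<close> into multiples of \<open>b\<close>. As
    \<open>Suc k < n\<close>, \<open>w\<close> is positive and can be cancelled at the end.\<close>
  define w where "w = (n - k) * Suc (Suc k)"
  have "a * c * w = (a * (n - k)) * (c * Suc (Suc k))"
    by (simp only: w_def mult_ac)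
  also have "\<dots> = (b * Suc k) * (b * (n - Suc k))"
    unfolding a_def b_def c_def by (simp only: binomial_step[symmetric])
  also have "\<dots> = b\<^sup>2 * ((n - Suc k) * Suc k)"
    by (simp only: power2_eq_square mult_ac)
  also have "\<dots> \<le> b\<^sup>2 * w"
    unfolding w_def by (intro mult_le_mono) auto
  finally show ?thesis
    using True by (simp add: a_def b_def c_def w_def)
qed (simp add: binomial_eq_0)

text \<open>This is log-concavity at index 2 with the linear coefficient raised by \<open>q\<close>.
  For n >= 3 the ratio of \<open>(n choose 2)\<^sup>2\<close> to \<open>n * (n choose 3)\<close> is
  3(n-1)/(2(n-2)) >= 3/2, while the hypothesis says that n + q is at most 3n/2.\<close>

lemma binomial_log_concave_perturbed_linear:
  assumes "2 * q \<le> n"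
  shows "(n + q) * (n choose 3) \<le> (n choose 2)\<^sup>2"
proof -
  have 2: "(n choose 2) * 2 = n * (n - 1)" and 3: "(n choose 3) * 3 = (n choose 2) * (n - 2)"
    using binomial_step[of n 1] binomial_step[of n 2] by (simp_all add: numeral_2_eq_2 numeral_3_eq_3)
  have "6 * ((n + q) * (n choose 3)) = (2 * (n + q)) * ((n choose 3) * 3)"
    by simp
  also have "\<dots> \<le> (3 * n) * ((n choose 3) * 3)"
    using assms by (intro mult_le_mono1) simp
  also have "\<dots> = 3 * (n choose 2) * (n * (n - 2))"
    unfolding 3 by (simp only: mult_ac)
  also have "\<dots> \<le> 3 * (n choose 2) * (n * (n - 1))"
    by (intro mult_le_mono) auto
  also have "\<dots> = 6 * (n choose 2)\<^sup>2"
    unfolding 2[symmetric] by (simp add: power2_eq_square)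
  finally show ?thesis by simp
qed

section \<open>Counting independent sets\<close>

lemma coeff_independence_poly:
  assumes "finite (pverts G)"
  shows "coeff (independence_poly G) k = int (num_indep_sets G k)"
proof (cases "k \<le> independence_number G")
  case True
  then show ?thesis
    by (simp add: independence_poly_def coeff_sum)
next
  case False
  \<comment> \<open>Finiteness makes \<open>Max\<close> a true upper bound, so nothing is lost by
    truncating the sum at the independence number.\<close>
  have "finite {S. indep_set G S}"
    by (rule finite_subset[of _ "Pow (pverts G)"]) (auto simp: indep_set_def assms)
  then have "finite {card S | S. indep_set G S}" by simp
  then have "card S \<le> independence_number G" if "indep_set G S" for S
    unfolding independence_number_def using that by (auto intro: Max_ge)
  then have "{S. indep_set G S \<and> card S = k} = {}"
    using False by auto
  then have "num_indep_sets G k = 0"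
    unfolding num_indep_sets_def by (simp only: card.empty)
  with False show ?thesis
    by (simp add: independence_poly_def coeff_sum)
qed

text \<open>The hypotheses describe the join of an edgeless graph on \<open>A\<close> with a
  complete graph on \<open>B\<close>. The empty set is counted among the subsets of
  \<open>A\<close>, so \<open>B\<close> contributes only at size 1.\<close>

lemma num_indep_sets_join:
  assumes "finite A" "finite B" "A \<inter> B = {}"
    and indep: "\<And>S. indep_set G S \<longleftrightarrow> S \<subseteq> A \<or> (\<exists>b\<in>B. S = {b})"
  shows "num_indep_sets G k = (card A choose k) + (if k = 1 then card B else 0)"
proof -
  have split: "{S. indep_set G S \<and> card S = k} =
    {S. S \<subseteq> A \<and> card S = k} \<union> (if k = 1 then (\<lambda>b. {b}) ` B else {})"
    by (auto simp: indep)
  have "card {S. indep_set G S \<and> card S = k} =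
    card {S. S \<subseteq> A \<and> card S = k} + card (if k = 1 then (\<lambda>b. {b}) ` B else {})"
    unfolding split using assms by (intro card_Un_disjoint) auto
  then show ?thesis
    using n_subsets[OF assms(1), of k]
    by (auto simp: num_indep_sets_def card_image)
qed

section \<open>The polynomial (1 + x)^n + q x\<close>

lemma log_concave_unimodal_binomial_plus_linear:
  fixes f :: "int poly"
  assumes coeff: "\<And>k. coeff f k = int ((n choose k) + (if k = 1 then q else 0))"
    and q: "2 * q \<le> n" and n: "1 \<le> n"
  shows "log_concave_poly f \<and> unimodal_poly f"
proof -
  have deg: "degree f = n"
  proof (rule antisym)
    show "degree f \<le> n"
      \<comment> \<open>\<open>1 \<le> n\<close> ensures that the extra linear term does not exceed
        degree \<open>n\<close>.\<close>
      using n by (intro degree_le) (auto simp: coeff)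
    show "n \<le> degree f"
      by (rule le_degree) (simp add: coeff)
  qed
  have "log_concave_poly f"
    unfolding log_concave_poly_def
  proof (intro allI impI)
    fix j assume "1 \<le> j \<and> j + 1 \<le> degree f"
    then obtain k where j: "j = Suc k"
      by (cases j) auto
    define s where "s k = (n choose k) + (if k = 1 then q else 0)" for k
    have "s k * s (Suc (Suc k)) \<le> (s (Suc k))\<^sup>2"
    \<comment> \<open>The raised coefficient sits in the product on the left only for
      \<open>k = 1\<close>, since \<open>Suc (Suc k)\<close> is at least 2. For \<open>k = 0\<close>
      it is squared on the right, which only helps.\<close>
    proof (cases "k = 1")
      case True
      then show ?thesis
        using binomial_log_concave_perturbed_linear[OF q]
        by (simp add: s_def numeral_2_eq_2 numeral_3_eq_3)
    next
      case False
      then have "s k * s (Suc (Suc k)) = (n choose k) * (n choose Suc (Suc k))"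
        by (simp add: s_def)
      also have "\<dots> \<le> (n choose Suc k)\<^sup>2"
        by (rule binomial_log_concave)
      also have "\<dots> \<le> (s (Suc k))\<^sup>2"
        by (rule power_mono) (auto simp: s_def)
      finally show ?thesis .
    qed
    then have "int (s k) * int (s (Suc (Suc k))) \<le> (int (s (Suc k)))\<^sup>2"
      by (metis of_nat_le_iff of_nat_mult of_nat_power)
    then show "coeff f (j - 1) * coeff f (j + 1) \<le> (coeff f j)\<^sup>2"
      by (simp add: j coeff s_def)
  qed
  moreover have "coeff f i > 0" if "i \<le> degree f" for i
    using that by (simp add: coeff deg)
  ultimately show ?thesis
    using log_concave_imp_unimodal_poly by blast
qed

section \<open>Multiples and zero divisors in residue rings\<close>

lemma int_multiples_below:
  fixes d :: int
  assumes "d > 0"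
  shows "{a. 0 \<le> a \<and> a < d * m \<and> d dvd a} = (\<lambda>x. d * x) ` {0..<m}"
  using assms by (auto simp: zero_le_mult_iff elim!: dvdE)

lemma card_int_multiples_below:
  fixes d :: int
  assumes "d > 0"
  shows "finite {a. 0 \<le> a \<and> a < d * m \<and> d dvd a}"
    and "card {a. 0 \<le> a \<and> a < d * m \<and> d dvd a} = nat m"
  using assms by (simp_all add: int_multiples_below card_image inj_on_def)

lemma nonzero_zero_divisors_residue_ring:
  "nonzero_zero_divisors (residue_ring m) =
    {a. 0 < a \<and> a < m \<and> (\<exists>b. 0 < b \<and> b < m \<and> m dvd a * b)}"
proof -
  have "a \<in> {0..m - 1} \<and> a \<noteq> 0 \<longleftrightarrow> 0 < a \<and> a < m" for a
    by auto
  then show ?thesis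
    unfolding nonzero_zero_divisors_def residue_ring_def
    by (simp add: Bex_def mod_eq_0_iff_dvd) (smt (verit) Collect_cong)
qed

section \<open>The zero divisor graph modulo the cube of a prime\<close>

context
  fixes p :: nat
  assumes prime_p: "prime p"
begin

lemma prime_int_p: "prime (int p)" and p_gt_1: "int p > 1"
  using prime_p prime_gt_1_nat[OF prime_p] by simp_all

lemma nonzero_zero_divisors_prime_cube:
  "nonzero_zero_divisors (residue_ring (int (p ^ 3))) = {a. 0 < a \<and> a < int p ^ 3 \<and> int p dvd a}"
proof -
  have "int p dvd a" if "0 < b" "b < int p ^ 3" "int p ^ 3 dvd a * b" for a b
  proof (rule ccontr)
    assume "\<not> int p dvd a"
    then have "coprime (int p ^ 3) a"
      using prime_int_p by (simp add: prime_imp_coprime)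
    then have "int p ^ 3 dvd b"
      using that(3) by (simp add: coprime_dvd_mult_right_iff)
    then show False
      using that zdvd_imp_le by fastforce
  qed
  moreover have "\<exists>b. 0 < b \<and> b < int p ^ 3 \<and> int p ^ 3 dvd a * b" if "int p dvd a" for a
  \<comment> \<open>The single residue p^2 annihilates every multiple of p.\<close>
  proof (intro exI[of _ "(int p)\<^sup>2"] conjI)
    show "0 < (int p)\<^sup>2" "(int p)\<^sup>2 < int p ^ 3"
      using p_gt_1 by simp_all
    show "int p ^ 3 dvd a * (int p)\<^sup>2"
      using that by (auto simp: power2_eq_square power3_eq_cube)
  qed
  ultimately have "(\<exists>b. 0 < b \<and> b < int p ^ 3 \<and> int p ^ 3 dvd a * b) \<longleftrightarrow> int p dvd a" for a
    by blast
  then show ?thesis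
    unfolding nonzero_zero_divisors_residue_ring of_nat_power by simp
qed

lemma indep_set_zero_divisor_graph_prime_cube:
  defines "A \<equiv> {a. 0 < a \<and> a < int p ^ 3 \<and> int p dvd a \<and> \<not> (int p)\<^sup>2 dvd a}"
    and "B \<equiv> {a. 0 < a \<and> a < int p ^ 3 \<and> (int p)\<^sup>2 dvd a}"
  shows "indep_set (zero_divisor_graph (residue_ring (int (p ^ 3)))) S
    \<longleftrightarrow> S \<subseteq> A \<or> (\<exists>b\<in>B. S = {b})"
proof -
  let ?V = "{a. 0 < a \<and> a < int p ^ 3 \<and> int p dvd a}"
  have V: "?V = A \<union> B"
    unfolding A_def B_def by (auto intro: dvd_trans[of "int p" "(int p)\<^sup>2"])
  have AA: "\<not> int p ^ 3 dvd a * b" if "a \<in> A" "b \<in> A" for a b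
  proof
    from that obtain a' b' where ab: "a = int p * a'" "b = int p * b'"
      unfolding A_def by (auto elim!: dvdE)
    assume "int p ^ 3 dvd a * b"
    \<comment> \<open>Cancelling p^2 leaves p dividing a product of cofactors; by primality it
      divides one of them, so p^2 divides \<open>a\<close> or \<open>b\<close>.\<close>
    then have "(int p)\<^sup>2 * int p dvd (int p)\<^sup>2 * (a' * b')"
      by (simp add: ab power2_eq_square power3_eq_cube mult_ac)
    then have "int p dvd a' * b'"
      using p_gt_1 by (subst (asm) dvd_mult_cancel_left) auto
    then have "int p dvd a' \<or> int p dvd b'"
      using prime_int_p by (simp add: prime_dvd_mult_iff)
    then show False
      using that by (auto simp: A_def ab power2_eq_square)
  qed
  have BV: "int p ^ 3 dvd a * b" if "a \<in> ?V" "b \<in> B" for a b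
    using that by (auto simp: B_def power2_eq_square power3_eq_cube elim!: dvdE)
  \<comment> \<open>Adjacency requires distinct vertices, so \<open>{b}\<close> stays independent
    although b * b vanishes for \<open>b\<close> in \<open>B\<close>.\<close>
  have "indep_set (zero_divisor_graph (residue_ring (int (p ^ 3)))) S
    \<longleftrightarrow> S \<subseteq> ?V \<and> (\<forall>u\<in>S. \<forall>v\<in>S. u \<noteq> v \<longrightarrow> \<not> int p ^ 3 dvd u * v)"
    unfolding indep_set_def zero_divisor_graph_def nonzero_zero_divisors_prime_cube
    by (auto simp: residue_ring_def mod_eq_0_iff_dvd)
  also have "\<dots> \<longleftrightarrow> S \<subseteq> A \<or> (\<exists>b\<in>B. S = {b})"
  proof (intro iffI; (elim disjE bexE)?)
    assume S: "S \<subseteq> ?V \<and> (\<forall>u\<in>S. \<forall>v\<in>S. u \<noteq> v \<longrightarrow> \<not> int p ^ 3 dvd u * v)"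
    show "S \<subseteq> A \<or> (\<exists>b\<in>B. S = {b})"
    proof (cases "S \<inter> B = {}")
      case True
      with S show ?thesis unfolding V by blast
    next
      case False
      \<comment> \<open>By \<open>BV\<close>, \<open>b\<close> is adjacent to every other vertex,
        which forces \<open>S = {b}\<close>.\<close>
      then obtain b where b: "b \<in> S" "b \<in> B" by blast
      with S BV have "u = b" if "u \<in> S" for u
        using that by blast
      with b show ?thesis by blast
    qed
  next
    assume "S \<subseteq> A"
    then show "S \<subseteq> ?V \<and> (\<forall>u\<in>S. \<forall>v\<in>S. u \<noteq> v \<longrightarrow> \<not> int p ^ 3 dvd u * v)"
      unfolding V using AA by (simp add: subset_iff)
  next
    fix b assume "b \<in> B" "S = {b}"
    then show "S \<subseteq> ?V \<and> (\<forall>u\<in>S. \<forall>v\<in>S. u \<noteq> v \<longrightarrow> \<not> int p ^ 3 dvd u * v)"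
      unfolding V by simp
  qed
  finally show ?thesis .
qed

lemma num_indep_sets_zero_divisor_graph_prime_cube:
  "num_indep_sets (zero_divisor_graph (residue_ring (int (p ^ 3)))) k =
    ((p\<^sup>2 - p) choose k) + (if k = 1 then p - 1 else 0)"
proof -
  \<comment> \<open>Both \<open>?M\<close> and \<open>?D\<close> include 0 so that they can be
    counted as multiples below d * m. It cancels in \<open>?A = ?M - ?D\<close>, while
    \<open>?B\<close> loses it explicitly, hence p - 1.\<close>
  let ?M = "{a. 0 \<le> a \<and> a < int p * (int p)\<^sup>2 \<and> int p dvd a}"
  let ?D = "{a. 0 \<le> a \<and> a < (int p)\<^sup>2 * int p \<and> (int p)\<^sup>2 dvd a}"
  let ?A = "{a. 0 < a \<and> a < int p ^ 3 \<and> int p dvd a \<and> \<not> (int p)\<^sup>2 dvd a}"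
  let ?B = "{a. 0 < a \<and> a < int p ^ 3 \<and> (int p)\<^sup>2 dvd a}"
  have cube: "int p * (int p)\<^sup>2 = int p ^ 3" "(int p)\<^sup>2 * int p = int p ^ 3"
    by (simp_all add: power2_eq_square power3_eq_cube)
  have M: "finite ?M" "card ?M = p\<^sup>2"
    using card_int_multiples_below[of "int p" "(int p)\<^sup>2"] p_gt_1
    by (simp_all flip: of_nat_power)
  have D: "finite ?D" "card ?D = p"
    using card_int_multiples_below[of "(int p)\<^sup>2" "int p"] p_gt_1 by simp_all
  have "?D \<subseteq> ?M"
    by (auto simp: cube intro: dvd_trans[of "int p" "(int p)\<^sup>2"])
  moreover have A: "?A = ?M - ?D"
    by (auto simp: cube order_le_less)
  ultimately have "finite ?A" "card ?A = p\<^sup>2 - p"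
    using M D by (simp_all add: card_Diff_subset)
  moreover have "?B = ?D - {0}"
    by (auto simp: cube)
  then have "finite ?B" "card ?B = p - 1"
    using D p_gt_1 by (simp_all add: card_Diff_singleton)
  ultimately show ?thesis
    by (subst num_indep_sets_join[of ?A ?B, OF _ _ _ indep_set_zero_divisor_graph_prime_cube]) auto
qed

end

theorem theorem2p2:
  fixes p :: nat
  assumes "prime p"
  shows "log_concave_poly (independence_poly (zero_divisor_graph (residue_ring (int (p ^ 3))))) \<and>
         unimodal_poly (independence_poly (zero_divisor_graph (residue_ring (int (p ^ 3)))))"
proof (rule log_concave_unimodal_binomial_plus_linear)
  have N: "p\<^sup>2 - p = p * (p - 1)"
    by (simp add: power2_eq_square diff_mult_distrib2)
  have p: "2 \<le> p"
    using assms by (rule prime_ge_2_nat)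
  \<comment> \<open>After factoring, the slack condition is just p >= 2 multiplied by p - 1; it is
    an equality for p = 2.\<close>
  then show "2 * (p - 1) \<le> p\<^sup>2 - p" "1 \<le> p\<^sup>2 - p"
    unfolding N by (simp_all add: Suc_le_eq)
  have "finite (pverts (zero_divisor_graph (residue_ring (int (p ^ 3)))))"
    unfolding zero_divisor_graph_def nonzero_zero_divisors_prime_cube[OF assms]
    by (auto intro: finite_subset[of _ "{0..int p ^ 3}"])
  then show "coeff (independence_poly (zero_divisor_graph (residue_ring (int (p ^ 3))))) k =
      int (((p\<^sup>2 - p) choose k) + (if k = 1 then p - 1 else 0))" for k
    by (simp only: coeff_independence_poly num_indep_sets_zero_divisor_graph_prime_cube[OF assms])
qed

end
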